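(* Define a sequence $(c_n)_{n\ge 0}$ of real numbers by $c_0=0$, $c_1=1$ and, for all $n\ge0$, $$c_{5n}=c_n,\quad c_{5n+1}=\sqrt3\,c_n+c_{n+1},\quad c_{5n+2}=2c_n+\sqrt3\,c_{n+1},\quad c_{5n+3}=\sqrt3\,c_n+2c_{n+1},\quad c_{5n+4}=c_n+\sqrt3\,c_{n+1}.$$ For $n\ge1$ let $t_n=\dfrac{\sqrt3\, c_{n+1}}{c_n}$. Then every positive rational number equals $t_n$ for some $n\ge 1$.
   Context: All $c_n$ with $n\ge 1$ are positive. *)

theory Defs
  imports Complex_Main
begin

text \<open>The recurrences for \<open>c (5 * n)\<close> and \<open>c (5 * n + 1)\<close> hold trivially at \<open>n = 0\<close>, so they are
  guarded here to make the recursion terminate; \<open>c_recurrence\<close> restores the unguarded form.\<close>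

function c :: "nat \<Rightarrow> real" where
  "c 0 = 0"
| "c 1 = 1"
| "n \<ge> 1 \<Longrightarrow> c (5 * n) = c n"
| "n \<ge> 1 \<Longrightarrow> c (5 * n + 1) = sqrt 3 * c n + c (n + 1)"
| "c (5 * n + 2) = 2 * c n + sqrt 3 * c (n + 1)"
| "c (5 * n + 3) = sqrt 3 * c n + 2 * c (n + 1)"
| "c (5 * n + 4) = c n + sqrt 3 * c (n + 1)"
proof -
  fix P :: bool and x :: nat
  assume a: "x = 0 \<Longrightarrow> P" "x = 1 \<Longrightarrow> P"
    "\<And>n. n \<ge> 1 \<Longrightarrow> x = 5 * n \<Longrightarrow> P" "\<And>n. n \<ge> 1 \<Longrightarrow> x = 5 * n + 1 \<Longrightarrow> P"
    "\<And>n. x = 5 * n + 2 \<Longrightarrow> P" "\<And>n. x = 5 * n + 3 \<Longrightarrow> P" "\<And>n. x = 5 * n + 4 \<Longrightarrow> P"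
  have "x = 0 \<or> x = 1 \<or> (x div 5 \<ge> 1 \<and> x = 5 * (x div 5)) \<or> (x div 5 \<ge> 1 \<and> x = 5 * (x div 5) + 1)
    \<or> x = 5 * (x div 5) + 2 \<or> x = 5 * (x div 5) + 3 \<or> x = 5 * (x div 5) + 4"
    by presburger
  then show P using a by metis
qed ((rule FalseE, presburger) | simp)+
termination by (relation "measure id") auto

lemma c_recurrence:
  "c 0 = 0" "c 1 = 1"
  "c (5 * n) = c n"
  "c (5 * n + 1) = sqrt 3 * c n + c (n + 1)"
  "c (5 * n + 2) = 2 * c n + sqrt 3 * c (n + 1)"
  "c (5 * n + 3) = sqrt 3 * c n + 2 * c (n + 1)"
  "c (5 * n + 4) = c n + sqrt 3 * c (n + 1)"
proof -
  show "c 0 = 0" "c 1 = 1" by (rule c.simps)+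
  show "c (5 * n) = c n" by (cases "n = 0") (simp_all add: c.simps(3))
  show "c (5 * n + 1) = sqrt 3 * c n + c (n + 1)"
  proof (cases "n = 0")
    case True
    then show ?thesis using c.simps(1) by simp
  next
    case False
    then show ?thesis by (intro c.simps(4)) simp
  qed
qed (rule c.simps)+

lemma c_pos: "n \<ge> 1 \<Longrightarrow> c n > 0"
proof (induction n rule: c.induct)
  case (5 n)
  then show ?case by (cases "n = 0") (auto simp only: c.simps intro!: add_nonneg_pos mult_pos_pos, simp_all)
next
  case (6 n)
  then show ?case by (cases "n = 0") (auto simp only: c.simps intro!: add_nonneg_pos mult_pos_pos, simp_all)
next
  case (7 n)
  then show ?case by (cases "n = 0") (auto simp only: c.simps intro!: add_nonneg_pos mult_pos_pos, simp_all)
qed (auto simp only: c.simps intro!: add_pos_pos mult_pos_pos, simp_all)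

definition t :: "nat \<Rightarrow> real" where
  "t n = sqrt 3 * c (n + 1) / c n"

end

theory Submission
  imports Defs
begin

text \<open>
  For \<open>x = t n\<close> the values \<open>t (5 * n), \<dots>, t (5 * n + 4)\<close> are
  \<open>x + 3\<close>, \<open>3 * (x + 2) / (x + 3)\<close>, \<open>(2 * x + 3) / (x + 2)\<close>, \<open>3 * (x + 1) / (2 * x + 3)\<close> and
  \<open>x / (x + 1)\<close>. These maps send the positive reals bijectively onto the intervals between
  consecutive points of \<open>0 < 1 < 3/2 < 2 < 3 < \<infinity>\<close>, whose interior endpoints are \<open>t 4\<close>, \<open>t 3\<close>,
  \<open>t 2\<close> and \<open>t 1\<close>. The inverse maps, applied to a fraction \<open>a / b\<close>, always decrease \<open>a + b\<close>, so a
  descent on \<open>a + b\<close> reaches every positive rational.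
\<close>

text \<open>The right-nested form is the one that multiplying out leaves behind, so the simplifier
  can remove paired roots.\<close>

lemma sqrt3_mult [simp]: "sqrt 3 * (sqrt 3 * x) = 3 * x"
  by (simp flip: mult.assoc)

text \<open>All of \<open>c (5 * n)\<close> to \<open>c (5 * n + 5)\<close> are linear forms in
  \<open>c n\<close> and \<open>c (n + 1)\<close>, so each quotient is a fractional linear function
  of \<open>t n\<close>.\<close>

lemma t_recurrence:
  assumes "n \<ge> 1"
  shows "t (5 * n) = t n + 3"
    and "t (5 * n + 1) = 3 * (t n + 2) / (t n + 3)"
    and "t (5 * n + 2) = (2 * t n + 3) / (t n + 2)"
    and "t (5 * n + 3) = 3 * (t n + 1) / (2 * t n + 3)"
    and "t (5 * n + 4) = t n / (t n + 1)"
proof -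
  define u v where "u = c n" and "v = c (n + 1)"
  have pos: "u > 0" "v > 0"
    using c_pos[of n] c_pos[of "n + 1"] assms by (auto simp: u_def v_def)
  have s: "sqrt 3 * v > 0" "sqrt 3 * u > 0"
    using pos by simp_all
  have t_n: "t n = sqrt 3 * v / u"
    by (simp add: t_def u_def v_def)
  \<comment> \<open>The last value comes from \<open>5 * n + 5 = 5 * (n + 1)\<close>; it is the
    numerator term of \<open>t (5 * n + 4)\<close>.\<close>
  have c_5n: "c (5 * n) = u" "c (5 * n + 1) = sqrt 3 * u + v" "c (5 * n + 2) = 2 * u + sqrt 3 * v"
    "c (5 * n + 3) = sqrt 3 * u + 2 * v" "c (5 * n + 4) = u + sqrt 3 * v"
    "c (5 * n + 5) = v"
    using c_recurrence(3)[of "n + 1"]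
    by (simp_all only: c_recurrence u_def v_def add_mult_distrib2 mult_1_right)
  have nz: "sqrt 3 * u + v \<noteq> 0" "2 * u + sqrt 3 * v \<noteq> 0" "sqrt 3 * u + 2 * v \<noteq> 0"
    "u + sqrt 3 * v \<noteq> 0" "sqrt 3 * v + 3 * u \<noteq> 0" "sqrt 3 * v + 2 * u \<noteq> 0"
    "2 * (sqrt 3 * v) + 3 * u \<noteq> 0" "sqrt 3 * v + u \<noteq> 0"
    using pos s by linarith+
  \<comment> \<open>Over the common denominator \<open>u\<close>, which then cancels in each
    quotient.\<close>
  have t_frac: "t n + 3 = (sqrt 3 * v + 3 * u) / u" "t n + 2 = (sqrt 3 * v + 2 * u) / u"
    "2 * t n + 3 = (2 * (sqrt 3 * v) + 3 * u) / u" "t n + 1 = (sqrt 3 * v + u) / u"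
    using pos by (simp_all add: t_n field_simps)
  have "t (5 * n) = sqrt 3 * (sqrt 3 * u + v) / u"
    using c_5n by (simp add: t_def del: c.simps)
  also have "\<dots> = t n + 3"
    by (simp add: t_frac algebra_simps)
  finally show "t (5 * n) = t n + 3" .
  have "t (5 * n + 1) = sqrt 3 * (2 * u + sqrt 3 * v) / (sqrt 3 * u + v)"
    using c_5n by (simp add: t_def del: c.simps)
  also have "\<dots> = 3 * (t n + 2) / (t n + 3)"
    using pos nz by (simp add: t_frac frac_eq_eq) (simp add: algebra_simps)
  finally show "t (5 * n + 1) = 3 * (t n + 2) / (t n + 3)" .
  have "t (5 * n + 2) = sqrt 3 * (sqrt 3 * u + 2 * v) / (2 * u + sqrt 3 * v)"
    using c_5n by (simp add: t_def numeral_3_eq_3 del: c.simps)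
  also have "\<dots> = (2 * t n + 3) / (t n + 2)"
    using pos nz by (simp add: t_frac frac_eq_eq) (simp add: algebra_simps)
  finally show "t (5 * n + 2) = (2 * t n + 3) / (t n + 2)" .
  have "t (5 * n + 3) = sqrt 3 * (u + sqrt 3 * v) / (sqrt 3 * u + 2 * v)"
    using c_5n by (simp add: t_def add.commute del: c.simps)
  also have "\<dots> = 3 * (t n + 1) / (2 * t n + 3)"
    using pos nz by (simp add: t_frac frac_eq_eq) (simp add: algebra_simps)
  finally show "t (5 * n + 3) = 3 * (t n + 1) / (2 * t n + 3)" .
  have "t (5 * n + 4) = sqrt 3 * v / (u + sqrt 3 * v)"
    using c_5n by (simp add: t_def add.commute del: c.simps)
  also have "\<dots> = t n / (t n + 1)"
    unfolding t_frac(4) unfolding t_n using pos by (simp add: add.commute)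
  finally show "t (5 * n + 4) = t n / (t n + 1)" .
qed

text \<open>As \<open>c 0 = 0\<close>, these values do not arise from \<open>t_recurrence\<close> at
  \<open>n = 0\<close>; they are read off from \<open>c 1\<close> to \<open>c 5\<close>.\<close>

lemma t_initial: "t 1 = 3" "t 2 = 2" "t 3 = 3 / 2" "t 4 = 1"
proof -
  have "c 1 = 1" "c 2 = sqrt 3" "c 3 = 2" "c 4 = sqrt 3" "c 5 = 1"
    using c_recurrence(5-7)[of 0] c_recurrence(3)[of 1] c_recurrence(1,2)
    by (simp_all add: numeral_2_eq_2)
  then show "t 1 = 3" "t 2 = 2" "t 3 = 3 / 2" "t 4 = 1"
    by (simp_all add: t_def eval_nat_numeral del: c.simps)
qed

text \<open>Fractions need not be in lowest terms: the inverse maps can create common factors, and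
  the descent on \<open>a + b\<close> never has to reduce them.\<close>

lemma t_surj_fractions:
  fixes a b :: int
  assumes "a > 0" "b > 0"
  shows "\<exists>n\<ge>1. t n = of_int a / of_int b"
  using assms
proof (induction "nat (a + b)" arbitrary: a b rule: less_induct)
  case less
  note pos = less.prems
  have descent: "\<exists>n\<ge>1. t n = of_int a' / of_int b'" if "a' > 0" "b' > 0" "a' + b' < a + b" for a' b'
    using less.hyps[of a' b'] that by simp
  \<comment> \<open>The position of \<open>a / b\<close> relative to 3, 2, 3/2 and 1, with
    denominators cleared.\<close>
  consider "a > 3 * b" | "a = 3 * b" | "2 * b < a" "a < 3 * b" | "a = 2 * b"
    | "3 * b < 2 * a" "a < 2 * b" | "2 * a = 3 * b" | "b < a" "2 * a < 3 * b" | "a = b" | "a < b"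
    by linarith
  then show ?case
  proof cases
    case 1
    then obtain n where n: "n \<ge> 1" "t n = of_int (a - 3 * b) / of_int b"
      using descent[of "a - 3 * b" b] pos by auto
    have "t (5 * n) = of_int a / of_int b"
      unfolding t_recurrence(1)[OF n(1)] n(2) using pos by (simp add: field_simps)
    then show ?thesis using n(1) by (intro exI[of _ "5 * n"]) simp
  next
    case 2
    then show ?thesis using t_initial(1) pos by (intro exI[of _ 1]) simp
  next
    case 3
    \<comment> \<open>This solves \<open>3 * (x + 2) / (x + 3) = a / b\<close> for \<open>x\<close>.
      The new sum is \<open>2 * a - 3 * b\<close>, smaller since \<open>a < 4 * b\<close>.\<close>
    then obtain n where n: "n \<ge> 1" "t n = of_int (3 * a - 6 * b) / of_int (3 * b - a)"
      using descent[of "3 * a - 6 * b" "3 * b - a"] pos by auto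
    have d: "of_int (3 * b - a) \<noteq> (0 :: real)" using 3 by linarith
    have "t n + 2 = of_int a / of_int (3 * b - a)" "t n + 3 = of_int (3 * b) / of_int (3 * b - a)"
      unfolding n(2) using d by (simp_all add: field_simps)
    then have "t (5 * n + 1) = of_int a / of_int b"
      unfolding t_recurrence(2)[OF n(1)] using d pos by simp
    then show ?thesis by (intro exI[of _ "5 * n + 1"]) simp
  next
    case 4
    then show ?thesis using t_initial(2) pos by (intro exI[of _ 2]) simp
  next
    case 5
    \<comment> \<open>The solution of \<open>(2 * x + 3) / (x + 2) = a / b\<close>; the new sum is
      \<open>a - b\<close>.\<close>
    then obtain n where n: "n \<ge> 1" "t n = of_int (2 * a - 3 * b) / of_int (2 * b - a)"
      using descent[of "2 * a - 3 * b" "2 * b - a"] pos by auto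
    have d: "of_int (2 * b - a) \<noteq> (0 :: real)" using 5 by linarith
    have "2 * t n + 3 = of_int a / of_int (2 * b - a)" "t n + 2 = of_int b / of_int (2 * b - a)"
      unfolding n(2) using d by (simp_all add: field_simps)
    then have "t (5 * n + 2) = of_int a / of_int b"
      unfolding t_recurrence(3)[OF n(1)] using d pos by simp
    then show ?thesis by (intro exI[of _ "5 * n + 2"]) simp
  next
    case 6
    then have "2 * real_of_int a = 3 * real_of_int b" by linarith
    then have "real_of_int a / real_of_int b = 3 / 2" using pos by (simp add: field_simps)
    then have "t 3 = of_int a / of_int b" by (simp only: t_initial(3))
    then show ?thesis by (intro exI[of _ 3]) simp
  next
    case 7
    \<comment> \<open>The solution of \<open>3 * (x + 1) / (2 * x + 3) = a / b\<close>; the new sum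
      is \<open>a\<close>.\<close>
    then obtain n where n: "n \<ge> 1" "t n = of_int (3 * a - 3 * b) / of_int (3 * b - 2 * a)"
      using descent[of "3 * a - 3 * b" "3 * b - 2 * a"] pos by auto
    have d: "of_int (3 * b - 2 * a) \<noteq> (0 :: real)" using 7 by linarith
    have "t n + 1 = of_int a / of_int (3 * b - 2 * a)"
      "2 * t n + 3 = of_int (3 * b) / of_int (3 * b - 2 * a)"
      unfolding n(2) using d by (simp_all add: field_simps)
    then have "t (5 * n + 3) = of_int a / of_int b"
      unfolding t_recurrence(4)[OF n(1)] using d pos by simp
    then show ?thesis by (intro exI[of _ "5 * n + 3"]) simp
  next
    case 8
    then show ?thesis using t_initial(4) pos by (intro exI[of _ 4]) simp
  next
    case 9
    \<comment> \<open>The solution of \<open>x / (x + 1) = a / b\<close>; the new sum is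
      \<open>b\<close>.\<close>
    then obtain n where n: "n \<ge> 1" "t n = of_int a / of_int (b - a)"
      using descent[of a "b - a"] pos by auto
    have d: "of_int (b - a) \<noteq> (0 :: real)" using 9 by linarith
    have "t n + 1 = of_int b / of_int (b - a)"
      unfolding n(2) using d by (simp add: field_simps)
    then have "t (5 * n + 4) = of_int a / of_int b"
      unfolding t_recurrence(5)[OF n(1)] using n(2) d pos by simp
    then show ?thesis by (intro exI[of _ "5 * n + 4"]) simp
  qed
qed

theorem theorem4:
  fixes q :: rat
  assumes "q > 0"
  shows "\<exists>n\<ge>1. t n = of_rat q"
proof -
  obtain a b where q: "q = Fract a b" "b > 0"
    by (cases q)
  with assms have "a > 0"
    by (simp add: zero_less_Fract_iff)
  then show ?thesis
    using t_surj_fractions[of a b] q by (simp add: of_rat_rat)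
qed

end
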